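(* Let $p,q \geq 1$ be integers, and let $\langle\cdot,\cdot\rangle$ be an arbitrary inner product of signature $(p,q)$ on the Lie algebra $\mathfrak{g}_{\mathbb{R}\mathrm{H}^{p+q}}$. Then there exist $k>0$, $\lambda \in \{0,1,2\}$, and a basis $\{x_1,\ldots,x_{p+q}\}$ of $\mathfrak{g}_{\mathbb{R}\mathrm{H}^{p+q}}$ which is pseudo-orthonormal with respect to $k\langle\cdot,\cdot\rangle$ and whose bracket relations are given by (i) $[x_1,x_i]=x_i$ for $i\in\{2,\ldots,p+q-1\}$, (ii) $[x_1,x_{p+q}]=-\lambda x_1+x_{p+q}$, (iii) $[x_i,x_{p+q}]=-\lambda x_i$ for $i\in\{2,\ldots,p+q-1\}$, with all remaining brackets, i.e. $[x_i,x_j]$ for $i,j\in\{2,\ldots,p+q-1\}$, equal to zero.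
   Context: For a positive integer $n$, $\mathfrak{g}_{\mathbb{R}\mathrm{H}^n}$ denotes the real Lie algebra with basis $\{e_1,\ldots,e_n\}$ whose only nonzero brackets (up to skew-symmetry) are $[e_1,e_j]=e_j$ for $j\in\{2,\ldots,n\}$. An inner product means a nondegenerate symmetric bilinear form, not necessarily positive definite. It has signature $(p,q)$ if its Gram matrix $A$ in some (equivalently any) basis satisfies ${}^t g A g = I_{p,q}:=\mathrm{diag}(1,\ldots,1,-1,\ldots,-1)$ ($p$ entries $1$ followed by $q$ entries $-1$) for some invertible $g$. With $n=p+q$, put $\varepsilon_i=1$ for $1\le i\le p$ and $\varepsilon_i=-1$ for $p+1\le i\le n$. A basis $\{x_1,\ldots,x_n\}$ is pseudo-orthonormal with respect to an inner product $\langle\cdot,\cdot\rangle$ of signature $(p,q)$ if $\langle x_i,x_j\rangle=\varepsilon_i\delta_{ij}$ for all $i,j$; in particular the ordering matters: the first $p$ vectors have norm square $+1$ and the last $q$ have norm square $-1$. *)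

theory Defs
  imports "HOL-Analysis.Linear_Algebra" "Jordan_Normal_Form.Matrix"
begin

text \<open>A basis of a real vector space (the whole type) is an ordered family indexed by
  \<open>{1..n}\<close>; values of the family outside this range are irrelevant.\<close>

definition basis_family :: "nat \<Rightarrow> (nat \<Rightarrow> 'a::real_vector) \<Rightarrow> bool" where
  "basis_family n x \<longleftrightarrow> inj_on x {1..n} \<and> independent (x ` {1..n}) \<and> span (x ` {1..n}) = UNIV"

definition lie_bracket :: "('a::real_vector \<Rightarrow> 'a \<Rightarrow> 'a) \<Rightarrow> bool" where
  "lie_bracket br \<longleftrightarrow> bilinear br \<and> (\<forall>x. br x x = 0) \<and>
     (\<forall>x y z. br x (br y z) + br y (br z x) + br z (br x y) = 0)"

text \<open>The bracket \<open>br\<close> makes the ambient vector space the Lie algebra of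
  \<open>\<real>H\<^sup>n\<close>, with \<open>e\<close> as its defining basis.\<close>

definition is_g_RH :: "nat \<Rightarrow> ('a::real_vector \<Rightarrow> 'a \<Rightarrow> 'a) \<Rightarrow> (nat \<Rightarrow> 'a) \<Rightarrow> bool" where
  "is_g_RH n br e \<longleftrightarrow> lie_bracket br \<and> basis_family n e \<and>
     (\<forall>j\<in>{2..n}. br (e 1) (e j) = e j) \<and>
     (\<forall>i\<in>{2..n}. \<forall>j\<in>{2..n}. br (e i) (e j) = 0)"

lemma ex_g_RH:
  assumes "n \<ge> 1" and "basis_family n (e :: nat \<Rightarrow> 'a::real_vector)"
  shows "\<exists>br. is_g_RH n br e"
proof -
  have inj: "inj_on e {1..n}" and ind: "independent (e ` {1..n})"
    using assms(2) by (auto simp: basis_family_def)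
  obtain t :: "'a \<Rightarrow> real" where lin: "linear t"
    and t: "\<And>v. v \<in> e ` {1..n} \<Longrightarrow> t v = (if v = e 1 then 1 else 0)"
    using linear_independent_extend[OF ind, of "\<lambda>v. if v = e 1 then 1 else 0 :: real"] by blast
  have t1: "t (e 1) = 1" using t[of "e 1"] assms(1) by auto
  have tj: "t (e j) = 0" if "j \<in> {2..n}" for j
  proof -
    have "e j \<noteq> e 1" using inj_onD[OF inj, of j 1] that by auto
    then show ?thesis using t[of "e j"] that by auto
  qed
  note l = linear_add[OF lin] linear_diff[OF lin] linear_scale[OF lin]
  define br where "br = (\<lambda>x y. t x *\<^sub>R y - t y *\<^sub>R x)"
  have "bilinear br"
    unfolding bilinear_def br_def by (auto intro!: linearI simp: l algebra_simps)
  then have "lie_bracket br"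
    by (simp add: lie_bracket_def br_def l algebra_simps)
  then have "is_g_RH n br e"
    using assms(2) t1 tj by (auto simp: is_g_RH_def br_def)
  then show ?thesis by blast
qed

definition indefinite_inner_product :: "('a::real_vector \<Rightarrow> 'a \<Rightarrow> real) \<Rightarrow> bool" where
  "indefinite_inner_product B \<longleftrightarrow> bilinear B \<and> (\<forall>x y. B x y = B y x) \<and>
     (\<forall>x. (\<forall>y. B x y = 0) \<longrightarrow> x = 0)"

text \<open>Matrix indices start at 0, basis indices at 1.\<close>

definition gram_mat :: "nat \<Rightarrow> ('a \<Rightarrow> 'a \<Rightarrow> real) \<Rightarrow> (nat \<Rightarrow> 'a) \<Rightarrow> real mat" where
  "gram_mat n B x = mat n n (\<lambda>(i, j). B (x (Suc i)) (x (Suc j)))"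

definition sign_mat :: "nat \<Rightarrow> nat \<Rightarrow> real mat" where
  "sign_mat p q = mat_diag (p + q) (\<lambda>i. if i < p then 1 else -1)"

definition has_signature :: "('a::real_vector \<Rightarrow> 'a \<Rightarrow> real) \<Rightarrow> nat \<Rightarrow> nat \<Rightarrow> bool" where
  "has_signature B p q \<longleftrightarrow> (\<exists>x. basis_family (p + q) x \<and>
     (\<exists>g \<in> carrier_mat (p + q) (p + q). invertible_mat g \<and>
        transpose_mat g * gram_mat (p + q) B x * g = sign_mat p q))"

definition pseudo_orthonormal_basis ::
  "nat \<Rightarrow> nat \<Rightarrow> ('a::real_vector \<Rightarrow> 'a \<Rightarrow> real) \<Rightarrow> (nat \<Rightarrow> 'a) \<Rightarrow> bool" where
  "pseudo_orthonormal_basis p q B x \<longleftrightarrow> basis_family (p + q) x \<and>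
     (\<forall>i\<in>{1..p + q}. \<forall>j\<in>{1..p + q}.
        B (x i) (x j) = (if i = j then (if i \<le> p then 1 else -1) else 0))"

end

theory Submission
  imports Defs
begin

text \<open>The bracket has the form \<open>[x,y] = t(x) y - t(y) x\<close> for a nonzero linear form \<open>t\<close>, which an
  inner product turns into a vector \<open>T\<close> with \<open>\<langle>T,x\<rangle> = t(x)\<close>. The required relations say exactly
  that \<open>t(x\<^sub>1) = 1\<close>, \<open>t(x\<^sub>n) = \<lambda>\<close> and \<open>t(x\<^sub>i) = 0\<close> otherwise, that is, \<open>T = x\<^sub>1 - \<lambda> x\<^sub>n\<close>, a vector
  of norm square \<open>1 - \<lambda>\<^sup>2 \<in> {1, 0, -3}\<close>. The sign of \<open>\<langle>T,T\<rangle>\<close> determines \<open>\<lambda>\<close>, and \<open>k\<close> normalises the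
  norm; Witt's theorem for single vectors then provides an isometry moving \<open>y\<^sub>1 - \<lambda> y\<^sub>n\<close>, for any
  pseudo-orthonormal basis \<open>y\<close>, to \<open>T\<close>.\<close>

section \<open>Arithmetic of indefinite inner products\<close>

lemma indefinite_inner_product_simps:
  assumes "indefinite_inner_product B"
  shows "B (x + y) z = B x z + B y z" "B z (x + y) = B z x + B z y"
    "B (x - y) z = B x z - B y z" "B z (x - y) = B z x - B z y"
    "B (c *\<^sub>R x) z = c * B x z" "B z (c *\<^sub>R x) = c * B z x"
    "B (- x) z = - B x z" "B z (- x) = - B z x"
  using assms
  by (auto simp: indefinite_inner_product_def bilinear_ladd bilinear_radd bilinear_lsub
      bilinear_rsub bilinear_lmul bilinear_rmul bilinear_lneg bilinear_rneg)

lemma indefinite_inner_product_commute: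
  "indefinite_inner_product B \<Longrightarrow> B x y = B y x"
  by (auto simp: indefinite_inner_product_def)

lemma indefinite_inner_product_sum_left:
  assumes "indefinite_inner_product B"
  shows "B (\<Sum>i\<in>S. f i) z = (\<Sum>i\<in>S. B (f i) z)"
proof -
  have "linear (\<lambda>x. B x z)"
    using assms by (auto simp: indefinite_inner_product_def bilinear_def)
  then show ?thesis by (rule linear_sum)
qed

lemma indefinite_inner_product_scale:
  assumes "indefinite_inner_product B" and "k \<noteq> 0"
  shows "indefinite_inner_product (\<lambda>u v. k * B u v)"
  using assms indefinite_inner_product_simps[OF assms(1)]
  by (auto simp: indefinite_inner_product_def bilinear_def linear_iff algebra_simps)

section \<open>Reflections and Witt's theorem for single vectors\<close>

text \<open>Equal norm squares make \<open>u + v\<close> orthogonal to \<open>u - v\<close>, so the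
  reflection along the non-null vector \<open>u - v\<close> exchanges \<open>u\<close> and
  \<open>v\<close>.\<close>

lemma reflection_isometry:
  assumes B: "indefinite_inner_product B"
    and eq: "B u u = B v v" and nz: "B (u - v) (u - v) \<noteq> 0"
  shows "\<exists>F. linear F \<and> (\<forall>x y. B (F x) (F y) = B x y) \<and> F u = v"
proof -
  note s = indefinite_inner_product_simps[OF B]
  define w where "w = u - v"
  define F where "F x = x - (2 * B x w / B w w) *\<^sub>R w" for x
  have nzw: "B w w \<noteq> 0" using nz by (simp add: w_def)
  have "linear F"
    by (rule linearI) (simp_all add: F_def s algebra_simps add_divide_distrib)
  moreover have "B (F x) (F y) = B x y" for x y
  proof -
    have "B (F x) (F y) = B x y - 2 * B y w / B w w * B x w
        - 2 * B x w / B w w * (B y w - 2 * B y w / B w w * B w w)"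
      by (simp add: F_def s indefinite_inner_product_commute[OF B, of w y] algebra_simps)
    then show ?thesis using nzw by simp
  qed
  \<comment> \<open>So the coefficient of \<open>w\<close> in \<open>F u\<close> is 1, and
    \<open>F u = u - w\<close>.\<close>
  moreover have "2 * B u w = B w w"
    using eq indefinite_inner_product_commute[OF B, of u v] by (simp add: w_def s)
  then have "F u = v" using nzw by (simp add: F_def) (simp add: w_def)
  ultimately show ?thesis by blast
qed

text \<open>If \<open>u - v\<close> or \<open>u + v\<close> is non-null, one reflection suffices,
  followed by a negation in the second case. The remaining case has both of them null.\<close>

theorem witt_vector:
  assumes B: "indefinite_inner_product B"
    and eq: "B u u = B v v" and "u \<noteq> 0" and "v \<noteq> 0"
  shows "\<exists>F. linear F \<and> (\<forall>x y. B (F x) (F y) = B x y) \<and> F u = v"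
proof -
  note s = indefinite_inner_product_simps[OF B]
  note c = indefinite_inner_product_commute[OF B]
  consider "B (u - v) (u - v) \<noteq> 0" | "B (u - - v) (u - - v) \<noteq> 0"
    | "B (u - v) (u - v) = 0" "B (u + v) (u + v) = 0" by auto
  then show ?thesis
  proof cases
    case 1
    then show ?thesis using reflection_isometry[OF B eq] by blast
  next
    case 2
    then obtain F where F: "linear F" "\<And>x y. B (F x) (F y) = B x y" "F u = - v"
      using reflection_isometry[OF B, of u "- v"] eq by (auto simp: s)
    then have "linear (\<lambda>x. - F x)" "\<forall>x y. B (- F x) (- F y) = B x y" "- F u = v"
      by (auto simp: s intro: linear_compose_neg)
    then show ?thesis by blast
  next
    case 3
    \<comment> \<open>Add and subtract the two null conditions.\<close>
    have uu: "B u u = 0" and uv: "B u v = 0"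
      using 3 eq c[of u v] by (simp_all add: s)
    have "\<exists>a. B u a \<noteq> 0" "\<exists>a. B v a \<noteq> 0"
      using B \<open>u \<noteq> 0\<close> \<open>v \<noteq> 0\<close> unfolding indefinite_inner_product_def by blast+
    then obtain a b where "B u a \<noteq> 0" "B v b \<noteq> 0" by blast
    \<comment> \<open>One of \<open>a\<close>, \<open>b\<close>, \<open>a + b\<close> works: the
      space is not the union of two hyperplanes.\<close>
    then have "\<exists>d. B u d \<noteq> 0 \<and> B v d \<noteq> 0"
      using s(2)[of u a b] s(2)[of v a b] by (metis add.left_neutral add.right_neutral)
    then obtain d where d: "B u d \<noteq> 0" "B v d \<noteq> 0" by blast
    txt \<open>No single reflection works here; two of them do, via a null vector \<open>w\<close> orthogonal to
      neither \<open>u\<close> nor \<open>v\<close>.\<close>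
    define w where "w = d - (B d d / (2 * B u d)) *\<^sub>R u"
    \<comment> \<open>The multiple of \<open>u\<close> cancels \<open>B d d\<close>; as
      \<open>u\<close> is orthogonal to \<open>u\<close> and \<open>v\<close>, it leaves the
      products of \<open>d\<close> with them unchanged.\<close>
    have ww: "B w w = 0" using d uu by (simp add: w_def s c[of d u])
    have uw: "B u w \<noteq> 0" using d uu by (simp add: w_def s)
    have vw: "B v w \<noteq> 0" using d uv by (simp add: w_def s c[of v u])
    \<comment> \<open>For null vectors, the norm square of a difference is -2 times their
      product.\<close>
    have "B (u - w) (u - w) \<noteq> 0" "B (w - v) (w - v) \<noteq> 0"
      using uu ww uw vw eq by (simp_all add: s c[of w u] c[of w v])
    moreover have "B u u = B w w" "B w w = B v v" using uu ww eq by simp_all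
    ultimately obtain F G where F: "linear F" "\<And>x y. B (F x) (F y) = B x y" "F u = w"
      and G: "linear G" "\<And>x y. B (G x) (G y) = B x y" "G w = v"
      using reflection_isometry[OF B] by metis
    then have "linear (G \<circ> F)" "\<forall>x y. B ((G \<circ> F) x) ((G \<circ> F) y) = B x y" "(G \<circ> F) u = v"
      by (simp_all add: linear_compose)
    then show ?thesis by blast
  qed
qed

section \<open>Pseudo-orthonormal bases\<close>

text \<open>Pairing a linear relation with \<open>y j\<close> isolates its \<open>j\<close>-th
  coefficient. The basis \<open>x\<close> supplies the dimension: a vector outside the span of
  \<open>y\<close> would give \<open>n + 1\<close> independent vectors.\<close>

lemma orthogonal_imp_basis_family:
  fixes x y :: "nat \<Rightarrow> 'a::real_vector"
  assumes x: "basis_family n x" and B: "indefinite_inner_product B"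
    and orth: "\<And>i j. i \<in> {1..n} \<Longrightarrow> j \<in> {1..n} \<Longrightarrow> i \<noteq> j \<Longrightarrow> B (y i) (y j) = 0"
    and nz: "\<And>i. i \<in> {1..n} \<Longrightarrow> B (y i) (y i) \<noteq> 0"
  shows "basis_family n y"
proof -
  have inj: "inj_on y {1..n}"
    by (rule inj_onI) (metis orth nz)
  have ind: "independent (y ` {1..n})"
  proof (rule independent_if_scalars_zero)
    fix f v assume 0: "(\<Sum>x\<in>y ` {1..n}. f x *\<^sub>R x) = 0" and "v \<in> y ` {1..n}"
    then obtain j where j: "j \<in> {1..n}" "v = y j" by blast
    have sum0: "(\<Sum>i=1..n. f (y i) *\<^sub>R y i) = 0" using 0 by (simp only: sum.reindex[OF inj] o_def)
    have "(\<Sum>i=1..n. f (y i) * B (y i) (y j)) = B (\<Sum>i=1..n. f (y i) *\<^sub>R y i) (y j)"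
      by (simp only: indefinite_inner_product_sum_left[OF B] indefinite_inner_product_simps(5)[OF B])
    also have "\<dots> = B 0 (y j)" by (simp only: sum0)
    also have "\<dots> = 0" using indefinite_inner_product_simps(5)[OF B, of 0 0] by simp
    also have "(\<Sum>i=1..n. f (y i) * B (y i) (y j)) =
        (\<Sum>i=1..n. if i = j then f (y j) * B (y j) (y j) else 0)"
      using orth j by (intro sum.cong) auto
    finally show "f v = 0" using j nz[of j] by simp
  qed simp
  have "v \<in> span (y ` {1..n})" for v
  proof (rule ccontr)
    assume v: "v \<notin> span (y ` {1..n})"
    then have "v \<notin> y ` {1..n}" using span_base by blast
    then have "card (insert v (y ` {1..n})) = Suc n"
      using card_image[OF inj] by simp
    moreover have "independent (insert v (y ` {1..n}))"
      using v ind by (rule independent_insertI)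
    then have "card (insert v (y ` {1..n})) \<le> card (x ` {1..n})"
      using x independent_span_bound[of "x ` {1..n}" "insert v (y ` {1..n})"]
      by (simp add: basis_family_def del: One_nat_def)
    moreover have "card (x ` {1..n}) = n"
      using x by (simp add: basis_family_def card_image)
    ultimately show False by simp
  qed
  then show ?thesis using inj ind by (auto simp: basis_family_def)
qed

lemma has_signature_imp_pseudo_orthonormal_basis:
  assumes B: "indefinite_inner_product B" and sig: "has_signature B p q"
  shows "\<exists>y. pseudo_orthonormal_basis p q B y"
proof -
  let ?n = "p + q"
  obtain x g where x: "basis_family ?n x" and g: "g \<in> carrier_mat ?n ?n"
    and eq: "transpose_mat g * gram_mat ?n B x * g = sign_mat p q"
    using sig by (auto simp: has_signature_def)
  \<comment> \<open>Column \<open>j - 1\<close> of \<open>g\<close> holds the coordinates of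
    \<open>y j\<close> in the basis \<open>x\<close>, so the Gram matrix of \<open>y\<close> is the
    product in \<open>eq\<close>.\<close>
  define y where "y j = (\<Sum>l<?n. g $$ (l, j - 1) *\<^sub>R x (Suc l))" for j
  have ip: "B (y i) (y j) = (if i = j then if i \<le> p then 1 else -1 else 0)"
    if "i \<in> {1..?n}" "j \<in> {1..?n}" for i j
  proof -
    obtain a b where ab: "i = Suc a" "j = Suc b" "a < ?n" "b < ?n"
      using \<open>i \<in> {1..?n}\<close> \<open>j \<in> {1..?n}\<close> by (cases i; cases j) auto
    have "B (y i) (y j) = (\<Sum>k<?n. \<Sum>l<?n. g $$ (k, a) * B (x (Suc k)) (x (Suc l)) * g $$ (l, b))"
      using bilinear_sum[of B "\<lambda>l. g $$ (l, a) *\<^sub>R x (Suc l)" "{..<?n}"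
          "\<lambda>l. g $$ (l, b) *\<^sub>R x (Suc l)" "{..<?n}"] B
      by (simp add: y_def ab indefinite_inner_product_simps[OF B] sum.cartesian_product
          indefinite_inner_product_def mult_ac)
    also have "\<dots> = (\<Sum>l<?n. (\<Sum>k<?n. g $$ (k, a) * B (x (Suc k)) (x (Suc l))) * g $$ (l, b))"
      by (subst sum.swap) (simp add: sum_distrib_right)
    also have "\<dots> = (transpose_mat g * gram_mat ?n B x * g) $$ (a, b)"
      using g ab by (simp add: gram_mat_def scalar_prod_def atLeast0LessThan)
    also have "\<dots> = (if i = j then if i \<le> p then 1 else -1 else 0)"
      unfolding eq using ab by (auto simp: sign_mat_def mat_diag_def)
    finally show ?thesis .
  qed
  moreover have "basis_family ?n y"
    by (rule orthogonal_imp_basis_family[OF x B]) (simp_all add: ip)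
  ultimately show ?thesis unfolding pseudo_orthonormal_basis_def by blast
qed

lemma pseudo_orthonormal_basis_scale:
  assumes B: "indefinite_inner_product B" and y: "pseudo_orthonormal_basis p q B y" and "k > 0"
  shows "pseudo_orthonormal_basis p q (\<lambda>u v. k * B u v) (\<lambda>i. (1 / sqrt k) *\<^sub>R y i)"
proof -
  note s = indefinite_inner_product_simps[OF B]
  have "k * B ((1 / sqrt k) *\<^sub>R u) ((1 / sqrt k) *\<^sub>R v) = B u v" for u v
    using \<open>k > 0\<close> by (simp add: s field_simps)
  moreover have "basis_family (p + q) (\<lambda>i. (1 / sqrt k) *\<^sub>R y i)"
    by (rule orthogonal_imp_basis_family[OF _ B, of _ y])
      (use y \<open>k > 0\<close> in \<open>auto simp: pseudo_orthonormal_basis_def s\<close>)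
  ultimately show ?thesis using y unfolding pseudo_orthonormal_basis_def by simp
qed

lemma pseudo_orthonormal_basis_isometry:
  assumes B: "indefinite_inner_product B" and y: "pseudo_orthonormal_basis p q B y"
    and F: "\<And>u v. B (F u) (F v) = B u v"
  shows "pseudo_orthonormal_basis p q B (\<lambda>i. F (y i))"
proof -
  have "basis_family (p + q) (\<lambda>i. F (y i))"
    by (rule orthogonal_imp_basis_family[OF _ B, of _ y])
      (use y in \<open>auto simp: pseudo_orthonormal_basis_def F\<close>)
  then show ?thesis using y by (simp add: pseudo_orthonormal_basis_def F)
qed

section \<open>The linear form behind the bracket\<close>

lemma linear_form_representable:
  assumes B: "indefinite_inner_product B" and y: "pseudo_orthonormal_basis p q B y"
    and t: "linear t"
  shows "\<exists>T. \<forall>v. B T v = t v"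
proof -
  note s = indefinite_inner_product_simps[OF B]
  \<comment> \<open>The sign \<open>B (y i) (y i)\<close> is its own inverse and cancels on pairing
    with \<open>y i\<close>.\<close>
  define T where "T = (\<Sum>i=1..p + q. (B (y i) (y i) * t (y i)) *\<^sub>R y i)"
  have "B T v = t v" for v
  proof (rule linear_eq_on[of "B T" t v "y ` {1..p + q}"])
    show "linear (B T)" using B by (auto simp: indefinite_inner_product_def bilinear_def)
    show "v \<in> span (y ` {1..p + q})"
      using y by (simp add: pseudo_orthonormal_basis_def basis_family_def)
    fix b assume "b \<in> y ` {1..p + q}"
    then obtain j where j: "j \<in> {1..p + q}" "b = y j" by blast
    have "B T b = (\<Sum>i=1..p + q. if i = j then t (y j) else 0)"
      unfolding T_def indefinite_inner_product_sum_left[OF B] s j(2)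
      using y j by (intro sum.cong) (auto simp: pseudo_orthonormal_basis_def)
    also have "\<dots> = t b" using j by simp
    finally show "B T b = t b" .
  qed (rule t)
  then show ?thesis by blast
qed

text \<open>Take for \<open>t\<close> the coordinate along \<open>e 1\<close>; both sides are then
  bilinear and agree on pairs of basis vectors.\<close>

lemma is_g_RH_linear_form:
  assumes "is_g_RH n br e" and "n \<ge> 1"
  shows "\<exists>t::_ \<Rightarrow> real. linear t \<and> t (e 1) = 1 \<and> (\<forall>x y. br x y = t x *\<^sub>R y - t y *\<^sub>R x)"
proof -
  have bil: "bilinear br" and zero: "\<And>x. br x x = 0" and e: "basis_family n e"
    and e1: "\<And>j. j \<in> {2..n} \<Longrightarrow> br (e 1) (e j) = e j"
    and e2: "\<And>i j. i \<in> {2..n} \<Longrightarrow> j \<in> {2..n} \<Longrightarrow> br (e i) (e j) = 0"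
    using assms(1) by (auto simp: is_g_RH_def lie_bracket_def)
  have "br x y + br y x = 0" for x y
  proof -
    have "0 = br (x + y) (x + y)" by (simp only: zero)
    also have "\<dots> = br x y + br y x"
      by (simp only: bilinear_ladd[OF bil] bilinear_radd[OF bil]) (simp add: zero)
    finally show ?thesis by simp
  qed
  then have skew: "br x y = - br y x" for x y by (simp add: eq_neg_iff_add_eq_0)
  have inj: "inj_on e {1..n}" and ind: "independent (e ` {1..n})" and sp: "span (e ` {1..n}) = UNIV"
    using e by (auto simp: basis_family_def)
  obtain t :: "_ \<Rightarrow> real" where t: "linear t"
    and te: "\<And>v. v \<in> e ` {1..n} \<Longrightarrow> t v = (if v = e 1 then 1 else 0)"
    using linear_independent_extend[OF ind, of "\<lambda>v. if v = e 1 then 1 else 0 :: real"] by blast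
  have t1: "t (e 1) = 1" using te[of "e 1"] assms(2) by auto
  have tj: "t (e j) = 0" if "j \<in> {2..n}" for j
    using te[of "e j"] inj_onD[OF inj, of j 1] that by auto
  have "br x y = t x *\<^sub>R y - t y *\<^sub>R x" for x y
  proof (rule bilinear_eq[OF bil, of "\<lambda>x y. t x *\<^sub>R y - t y *\<^sub>R x" UNIV "e ` {1..n}" UNIV "e ` {1..n}"])
    show "bilinear (\<lambda>x y. t x *\<^sub>R y - t y *\<^sub>R x)"
      unfolding bilinear_def
      by (auto intro!: linearI simp: linear_add[OF t] linear_scale[OF t] algebra_simps)
    fix u v assume "u \<in> e ` {1..n}" "v \<in> e ` {1..n}"
    then obtain i j where ij: "u = e i" "v = e j" "i \<in> {1..n}" "j \<in> {1..n}" by blast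
    have "i = 1 \<or> i \<in> {2..n}" "j = 1 \<or> j \<in> {2..n}" using ij by auto
    then show "br u v = t u *\<^sub>R v - t v *\<^sub>R u"
      using ij t1 tj e1 e2 zero skew[of "e i" "e 1"] by auto
  qed (simp_all add: sp del: One_nat_def)
  then show ?thesis using t t1 by blast
qed

theorem theorem1p1:
  fixes p q :: nat
    and br :: "'a::real_vector \<Rightarrow> 'a \<Rightarrow> 'a"
    and e :: "nat \<Rightarrow> 'a"
    and B :: "'a \<Rightarrow> 'a \<Rightarrow> real"
  assumes "p \<ge> 1" and "q \<ge> 1"
    and "is_g_RH (p + q) br e"
    and "indefinite_inner_product B"
    and "has_signature B p q"
  shows "\<exists>k>0. \<exists>l\<in>{0, 1, 2 :: real}. \<exists>x :: nat \<Rightarrow> 'a.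
    pseudo_orthonormal_basis p q (\<lambda>u v. k * B u v) x \<and>
    (\<forall>i\<in>{2..p + q - 1}. br (x 1) (x i) = x i) \<and>
    br (x 1) (x (p + q)) = - (l *\<^sub>R x 1) + x (p + q) \<and>
    (\<forall>i\<in>{2..p + q - 1}. br (x i) (x (p + q)) = - (l *\<^sub>R x i)) \<and>
    (\<forall>i\<in>{2..p + q - 1}. \<forall>j\<in>{2..p + q - 1}. br (x i) (x j) = 0)"
proof -
  let ?n = "p + q"
  have B: "indefinite_inner_product B" by fact
  obtain t :: "'a \<Rightarrow> real" where t: "linear t" "t (e 1) = 1"
    and br: "\<And>x y. br x y = t x *\<^sub>R y - t y *\<^sub>R x"
    using is_g_RH_linear_form[OF assms(3)] \<open>p \<ge> 1\<close> by auto
  obtain z where z: "pseudo_orthonormal_basis p q B z"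
    using has_signature_imp_pseudo_orthonormal_basis[OF B assms(5)] by blast
  obtain T where T: "\<And>v. B T v = t v"
    using linear_form_representable[OF B z t(1)] by blast
  \<comment> \<open>\<open>t T\<close> is \<open>B T T\<close>. For \<open>k * B\<close> the form
    \<open>t\<close> is represented by \<open>T\<close> divided by \<open>k\<close>, of norm square
    \<open>t T / k\<close>, which has to equal \<open>1 - l\<^sup>2\<close>.\<close>
  have "\<exists>k>0. \<exists>l\<in>{0, 1, 2 :: real}. t T = k * (1 - l\<^sup>2)"
  proof (cases "t T" "0 :: real" rule: linorder_cases)
    case less
    then show ?thesis by (intro exI[of _ "- t T / 3"] conjI bexI[of _ 2]) auto
  next
    case equal
    then show ?thesis by (intro exI[of _ 1] conjI bexI[of _ 1]) auto
  next
    case greater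
    then show ?thesis by (intro exI[of _ "t T"] conjI bexI[of _ 0]) auto
  qed
  then obtain k l where k: "k > 0" and l: "l \<in> {0, 1, 2 :: real}" and kl: "t T = k * (1 - l\<^sup>2)"
    by blast
  define C where "C u v = k * B u v" for u v
  have C: "indefinite_inner_product C"
    unfolding C_def using indefinite_inner_product_scale[OF B] k by simp
  note s = indefinite_inner_product_simps[OF C]
  obtain y where y: "pseudo_orthonormal_basis p q C y"
    using pseudo_orthonormal_basis_scale[OF B z k] unfolding C_def by blast
  have Cy: "C (y i) (y j) = (if i = j then if i \<le> p then 1 else -1 else 0)"
    if "i \<in> {1..?n}" "j \<in> {1..?n}" for i j
    using y that by (simp add: pseudo_orthonormal_basis_def)
  define S where "S = (1 / k) *\<^sub>R T"
  have CS: "C S v = t v" for v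
    using k by (simp add: S_def s) (simp add: C_def T)
  define u where "u = y 1 - l *\<^sub>R y ?n"
  \<comment> \<open>As \<open>q\<close> is positive, \<open>y ?n\<close> has norm square -1, so its
    coefficient \<open>- l\<close> in \<open>u\<close> turns into the product \<open>l\<close>
    below.\<close>
  have n: "1 \<in> {1..?n}" "?n \<in> {1..?n}" "1 \<noteq> ?n" "\<not> ?n \<le> p" using assms(1,2) by auto
  have Cu: "C u (y i) = (if i = 1 then 1 else if i = ?n then l else 0)" if "i \<in> {1..?n}" for i
    using that n assms(1) by (auto simp: u_def s Cy)
  have "C u u = 1 - l\<^sup>2"
    using Cu[OF n(1)] Cu[OF n(2)] n(3) unfolding u_def by (simp add: s power2_eq_square)
  moreover have "C S S = 1 - l\<^sup>2"
    using k kl linear_scale[OF t(1)] by (simp add: CS) (simp add: S_def)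
  \<comment> \<open>For \<open>l = 1\<close> both vectors are null, so their norms do not exclude
    zero; instead \<open>S\<close> pairs to 1 with \<open>e 1\<close>, and \<open>u\<close> with
    \<open>y 1\<close>.\<close>
  moreover have "S \<noteq> 0"
    using CS[of "e 1"] t(2) s(5)[of 0 0] by auto
  moreover have "u \<noteq> 0"
    using Cu[OF n(1)] s(5)[of 0 0] by auto
  ultimately obtain F where F: "\<And>x y. C (F x) (F y) = C x y" "F u = S"
    using witt_vector[OF C, of u S] by auto
  define x where "x i = F (y i)" for i
  have x: "pseudo_orthonormal_basis p q C x"
    unfolding x_def using pseudo_orthonormal_basis_isometry[OF C y] F(1) by blast
  \<comment> \<open>\<open>t (x i)\<close> is \<open>C (F u) (F (y i))\<close>, hence
    \<open>C u (y i)\<close>.\<close>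
  have tx: "t (x i) = (if i = 1 then 1 else if i = ?n then l else 0)" if "i \<in> {1..?n}" for i
    using Cu[OF that] F(1)[of u "y i"] CS[of "x i"] by (simp add: F(2) x_def)
  have t1: "t (x 1) = 1" and tn: "t (x ?n) = l" using tx[OF n(1)] tx[OF n(2)] n(3) by auto
  have ti: "t (x i) = 0" if "i \<in> {2..?n - 1}" for i using tx[of i] that by auto
  show ?thesis
  proof (intro exI[of _ k] conjI bexI[of _ l] exI[of _ x])
    show "pseudo_orthonormal_basis p q (\<lambda>u v. k * B u v) x"
      using x unfolding C_def .
  qed (use k l in \<open>simp_all add: br t1 tn ti del: One_nat_def\<close>)
qed

end
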